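(* Let $D$ be a finite set with $|D|\ge 2$, let $\mathbb{P}_0=(p_{0s})_{s\in D}$ be a probability measure on $D$ with $p_{0s}>0$ for all $s$, and let $c\ge 1$ satisfy $c<\min_{s\in D}\frac{1}{1-p_{0s}}$. Let there be a single risky asset ($K=1$) with non-constant payoff $S:D\to\mathbb{R}$, and put $\underline S=\min_{s\in D}S_s$, $\overline S=\max_{s\in D}S_s$. Let $\alpha\in[1/2,1]$ and let $u$ be a strictly concave, twice differentiable utility function satisfying the Inada conditions. Let $\theta^*(\pi)$ denote the optimal demand at price $\pi$, i.e. the maximizer of $V_\alpha$ over the admissible set $\Theta$. Then: (i) $\theta^*(\pi)$ is unique and finite for all $\pi\in(\underline S,\overline S)$. (ii) $\theta^*$ is continuous on $(\underline S,\overline S)$, equal to zero on $[\underline\pi,\overline\pi]$, with $\theta^*(\pi)>0$ for $\pi\in(\underline S,\underline\pi)$ and $\theta^*(\pi)<0$ for $\pi\in(\overline\pi,\overline S)$. (iii) $\lim_{\pi\downarrow\underline S}\theta^*(\pi)=\overline\Theta$ and $\lim_{\pi\uparrow\overline S}\theta^*(\pi)=\underline\Theta$, where $\overline\Theta$ and $\underline\Theta$ are understood as their limits as $\pi\downarrow\underline S$ and $\pi\uparrow\overline S$, respectively (i.e. $+\infty$ and $-\infty$).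
   Context: With initial wealth $w_0$ and price $\pi$, $W^\theta=w_0+\theta(S-\pi)$ and $$V_\alpha(\theta)=\alpha\min_{P\in\mathcal{X}}\mathbb{E}_P[u(W^\theta)]+(1-\alpha)\max_{P\in\mathcal{X}}\mathbb{E}_P[u(W^\theta)],$$ where $\mathcal{X}=\{P: P(s)\ge 0\ \forall s\in D,\ \sum_{s}P(s)=1,\ \sum_{s}P(s)^2/p_{0s}\le c\}$. Write $\mathbb{E}_0,\mathbb{S}_0$ for expectation and standard deviation under $\mathbb{P}_0$, $\delta=\sqrt{c-1}\,(2\alpha-1)$, and $$\overline\pi=\mathbb{E}_0[S]+|\delta|\,\mathbb{S}_0[S],\qquad \underline\pi=\mathbb{E}_0[S]-|\delta|\,\mathbb{S}_0[S].$$ Two cases are considered. (1) $u$ is defined on all of $\mathbb{R}$: the admissible set is $\Theta=\mathbb{R}$, with $\underline\Theta=-\infty$, $\overline\Theta=+\infty$. (2) $u$ is defined only on $(0,\infty)$: $w_0>0$ and $\Theta=\{\theta\in\mathbb{R}: w_0+\theta(S_s-\pi)>0\ \forall s\in D\}$, with $\underline\Theta=-\frac{w_0}{\overline S-\pi}$, $\overline\Theta=\frac{w_0}{\pi-\underline S}$. Inada conditions: $\lim_{x\downarrow-\infty}u'(x)=+\infty$ in case (1), $\lim_{x\downarrow0}u'(x)=+\infty$ in case (2), and $\lim_{x\uparrow+\infty}u'(x)=0$ in both cases. *)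

theory Defs
  imports "HOL-Probability.Probability"
begin

text \<open>
  The finite state space \<open>D\<close> is a type of class \<open>finite\<close>, and probability measures on \<open>D\<close> are
  elements of \<open>'d pmf\<close>.
\<close>

definition prior_set :: "'d::finite pmf \<Rightarrow> real \<Rightarrow> 'd pmf set" where
  "prior_set P0 c = {P. (\<Sum>s\<in>UNIV. (pmf P s)\<^sup>2 / pmf P0 s) \<le> c}"

definition std_dev :: "'d pmf \<Rightarrow> ('d \<Rightarrow> real) \<Rightarrow> real" where
  "std_dev P X = sqrt (measure_pmf.variance P X)"

text \<open>
  \<open>Whole_Line\<close>: the utility function is defined on all of \<open>\<real>\<close>.
  \<open>Positive_Half_Line\<close>: it is defined only on \<open>(0, \<infinity>)\<close>; the values of the total HOL function
  outside that interval are irrelevant.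
\<close>

datatype utility_case = Whole_Line | Positive_Half_Line

fun utility_dom :: "utility_case \<Rightarrow> real set" where
  "utility_dom Whole_Line = UNIV"
| "utility_dom Positive_Half_Line = {0<..}"

fun lower_end :: "utility_case \<Rightarrow> real filter" where
  "lower_end Whole_Line = at_bot"
| "lower_end Positive_Half_Line = at_right 0"

definition strictly_concave_on :: "real set \<Rightarrow> (real \<Rightarrow> real) \<Rightarrow> bool" where
  "strictly_concave_on A f \<longleftrightarrow>
    convex A \<and>
    (\<forall>x\<in>A. \<forall>y\<in>A. \<forall>t. x \<noteq> y \<and> 0 < t \<and> t < 1 \<longrightarrow>
      (1 - t) * f x + t * f y < f ((1 - t) * x + t * y))"

definition twice_differentiable_on :: "real set \<Rightarrow> (real \<Rightarrow> real) \<Rightarrow> bool" where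
  "twice_differentiable_on A f \<longleftrightarrow>
    (\<forall>x\<in>A. f differentiable (at x) \<and> deriv f differentiable (at x))"

definition inada :: "utility_case \<Rightarrow> (real \<Rightarrow> real) \<Rightarrow> bool" where
  "inada k u \<longleftrightarrow>
    filterlim (deriv u) at_top (lower_end k) \<and> (deriv u \<longlongrightarrow> 0) at_top"

definition wealth :: "real \<Rightarrow> ('d \<Rightarrow> real) \<Rightarrow> real \<Rightarrow> real \<Rightarrow> 'd \<Rightarrow> real" where
  "wealth w0 S \<pi> \<theta> s = w0 + \<theta> * (S s - \<pi>)"

fun admissible :: "utility_case \<Rightarrow> real \<Rightarrow> ('d \<Rightarrow> real) \<Rightarrow> real \<Rightarrow> real set" where
  "admissible Whole_Line w0 S \<pi> = UNIV"
| "admissible Positive_Half_Line w0 S \<pi> = {\<theta>. \<forall>s. wealth w0 S \<pi> \<theta> s > 0}"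

fun admissible_lower :: "utility_case \<Rightarrow> real \<Rightarrow> ('d::finite \<Rightarrow> real) \<Rightarrow> real \<Rightarrow> ereal" where
  "admissible_lower Whole_Line w0 S \<pi> = -\<infinity>"
| "admissible_lower Positive_Half_Line w0 S \<pi> = ereal (- (w0 / ((MAX s. S s) - \<pi>)))"

fun admissible_upper :: "utility_case \<Rightarrow> real \<Rightarrow> ('d::finite \<Rightarrow> real) \<Rightarrow> real \<Rightarrow> ereal" where
  "admissible_upper Whole_Line w0 S \<pi> = \<infinity>"
| "admissible_upper Positive_Half_Line w0 S \<pi> = ereal (w0 / (\<pi> - (MIN s. S s)))"

text \<open>
  The infimum and the supremum below are a minimum and a maximum, since the set of priors is
  compact; see \<open>prior_set_INF_attained\<close> and \<open>prior_set_SUP_attained\<close>.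
\<close>

definition alpha_maxmin ::
  "real \<Rightarrow> (real \<Rightarrow> real) \<Rightarrow> 'd::finite pmf \<Rightarrow> real \<Rightarrow> real \<Rightarrow> ('d \<Rightarrow> real) \<Rightarrow> real \<Rightarrow> real \<Rightarrow> real"
where
  "alpha_maxmin \<alpha> u P0 c w0 S \<pi> \<theta> =
    \<alpha> * (INF P\<in>prior_set P0 c. measure_pmf.expectation P (\<lambda>s. u (wealth w0 S \<pi> \<theta> s))) +
    (1 - \<alpha>) * (SUP P\<in>prior_set P0 c. measure_pmf.expectation P (\<lambda>s. u (wealth w0 S \<pi> \<theta> s)))"

definition is_optimal ::
  "utility_case \<Rightarrow> real \<Rightarrow> (real \<Rightarrow> real) \<Rightarrow> 'd::finite pmf \<Rightarrow> real \<Rightarrow> real \<Rightarrow> ('d \<Rightarrow> real) \<Rightarrow> real \<Rightarrow>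
    real \<Rightarrow> bool"
where
  "is_optimal k \<alpha> u P0 c w0 S \<pi> \<theta> \<longleftrightarrow>
    is_arg_max (alpha_maxmin \<alpha> u P0 c w0 S \<pi>) (\<lambda>\<theta>. \<theta> \<in> admissible k w0 S \<pi>) \<theta>"

definition demand ::
  "utility_case \<Rightarrow> real \<Rightarrow> (real \<Rightarrow> real) \<Rightarrow> 'd::finite pmf \<Rightarrow> real \<Rightarrow> real \<Rightarrow> ('d \<Rightarrow> real) \<Rightarrow> real \<Rightarrow>
    real"
where
  "demand k \<alpha> u P0 c w0 S \<pi> = (THE \<theta>. is_optimal k \<alpha> u P0 c w0 S \<pi> \<theta>)"

definition ambiguity_delta :: "real \<Rightarrow> real \<Rightarrow> real" where
  "ambiguity_delta c \<alpha> = sqrt (c - 1) * (2 * \<alpha> - 1)"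

definition upper_price :: "real \<Rightarrow> 'd pmf \<Rightarrow> real \<Rightarrow> ('d \<Rightarrow> real) \<Rightarrow> real" where
  "upper_price \<alpha> P0 c S =
    measure_pmf.expectation P0 S + \<bar>ambiguity_delta c \<alpha>\<bar> * std_dev P0 S"

definition lower_price :: "real \<Rightarrow> 'd pmf \<Rightarrow> real \<Rightarrow> ('d \<Rightarrow> real) \<Rightarrow> real" where
  "lower_price \<alpha> P0 c S =
    measure_pmf.expectation P0 S - \<bar>ambiguity_delta c \<alpha>\<bar> * std_dev P0 S"


lemma expectation_pmf_finite:
  fixes P :: "'d::finite pmf" and f :: "'d \<Rightarrow> real"
  shows "measure_pmf.expectation P f = (\<Sum>s\<in>UNIV. pmf P s * f s)"
  by (subst integral_measure_pmf[of UNIV]) auto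

lemma pmf_vec_ex:
  fixes x :: "real ^ 'd"
  assumes "\<And>s. 0 \<le> x $ s" and "(\<Sum>s\<in>UNIV. x $ s) = 1"
  obtains P where "\<And>s. pmf P s = x $ s"
proof
  have "(\<integral>\<^sup>+ s. ennreal (x $ s) \<partial>count_space UNIV) = 1"
    using assms by (simp add: nn_integral_count_space_finite sum_ennreal)
  then show "pmf (embed_pmf (\<lambda>s. x $ s)) s = x $ s" for s
    using assms by (intro pmf_embed_pmf) auto
qed

lemma prior_set_nonempty:
  fixes P0 :: "'d::finite pmf"
  assumes "\<And>s. pmf P0 s > 0" and "c \<ge> 1"
  shows "P0 \<in> prior_set P0 c"
proof -
  have "(\<Sum>s\<in>UNIV. (pmf P0 s)\<^sup>2 / pmf P0 s) = (\<Sum>s\<in>UNIV. pmf P0 s)"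
    using assms(1) by (intro sum.cong) (auto simp: power2_eq_square less_imp_neq[symmetric])
  also have "\<dots> = 1"
    by (rule sum_pmf_eq_1) auto
  finally show ?thesis
    using assms(2) by (simp add: prior_set_def)
qed

definition pmf_vec :: "'d::finite pmf \<Rightarrow> real ^ 'd" where
  "pmf_vec P = (\<chi> s. pmf P s)"

lemma compact_prior_set:
  fixes P0 :: "'d::finite pmf"
  assumes "\<And>s. pmf P0 s > 0"
  shows "compact (pmf_vec ` prior_set P0 c)"
proof -
  let ?K = "{x :: real ^ 'd. (\<forall>s. 0 \<le> x $ s) \<and> (\<Sum>s\<in>UNIV. x $ s) = 1 \<and>
              (\<Sum>s\<in>UNIV. (x $ s)\<^sup>2 / pmf P0 s) \<le> c}"
  have "pmf_vec ` prior_set P0 c = ?K"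
  proof (intro equalityI subsetI)
    fix x assume "x \<in> pmf_vec ` prior_set P0 c"
    then show "x \<in> ?K"
      by (auto simp: pmf_vec_def prior_set_def sum_pmf_eq_1)
  next
    fix x assume x: "x \<in> ?K"
    then obtain P where P: "\<And>s. pmf P s = x $ s"
      using pmf_vec_ex[of x] by auto
    then have "x = pmf_vec P" "P \<in> prior_set P0 c"
      using x by (auto simp: pmf_vec_def prior_set_def vec_eq_iff)
    then show "x \<in> pmf_vec ` prior_set P0 c" by blast
  qed
  moreover have "closed ?K"
    using assms
    by (intro closed_Collect_conj closed_Collect_all closed_Collect_le closed_Collect_eq
          continuous_intros) (auto simp: less_imp_neq[symmetric])
  moreover have "bounded ?K"
  proof (rule boundedI)
    fix x assume "x \<in> ?K"
    moreover have "norm x \<le> (\<Sum>s\<in>UNIV. \<bar>x $ s\<bar>)"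
      by (rule norm_le_l1_cart)
    ultimately show "norm x \<le> 1" by simp
  qed
  ultimately show ?thesis
    by (simp add: compact_eq_bounded_closed)
qed

lemma prior_set_INF_attained:
  fixes P0 :: "'d::finite pmf" and f :: "'d \<Rightarrow> real"
  assumes "\<And>s. pmf P0 s > 0" and "c \<ge> 1"
  obtains Q where "Q \<in> prior_set P0 c"
    and "\<And>P. P \<in> prior_set P0 c \<Longrightarrow> measure_pmf.expectation Q f \<le> measure_pmf.expectation P f"
    and "(INF P\<in>prior_set P0 c. measure_pmf.expectation P f) = measure_pmf.expectation Q f"
proof -
  have "continuous_on (pmf_vec ` prior_set P0 c) (\<lambda>x. \<Sum>s\<in>UNIV. x $ s * f s)"
    by (intro continuous_intros)
  from continuous_attains_inf[OF compact_prior_set[OF assms(1)] _ this]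
  obtain Q where Q: "Q \<in> prior_set P0 c"
    and le: "\<And>P. P \<in> prior_set P0 c \<Longrightarrow>
      measure_pmf.expectation Q f \<le> measure_pmf.expectation P f"
    using prior_set_nonempty[OF assms] by (fastforce simp: pmf_vec_def expectation_pmf_finite)
  moreover have "(INF P\<in>prior_set P0 c. measure_pmf.expectation P f) = measure_pmf.expectation Q f"
    using Q le by (intro cInf_eq_minimum) auto
  ultimately show thesis by (rule that)
qed

lemma prior_set_SUP_attained:
  fixes P0 :: "'d::finite pmf" and f :: "'d \<Rightarrow> real"
  assumes "\<And>s. pmf P0 s > 0" and "c \<ge> 1"
  obtains Q where "Q \<in> prior_set P0 c"
    and "\<And>P. P \<in> prior_set P0 c \<Longrightarrow> measure_pmf.expectation P f \<le> measure_pmf.expectation Q f"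
    and "(SUP P\<in>prior_set P0 c. measure_pmf.expectation P f) = measure_pmf.expectation Q f"
proof -
  have "continuous_on (pmf_vec ` prior_set P0 c) (\<lambda>x. \<Sum>s\<in>UNIV. x $ s * f s)"
    by (intro continuous_intros)
  from continuous_attains_sup[OF compact_prior_set[OF assms(1)] _ this]
  obtain Q where Q: "Q \<in> prior_set P0 c"
    and le: "\<And>P. P \<in> prior_set P0 c \<Longrightarrow>
      measure_pmf.expectation P f \<le> measure_pmf.expectation Q f"
    using prior_set_nonempty[OF assms] by (fastforce simp: pmf_vec_def expectation_pmf_finite)
  moreover have "(SUP P\<in>prior_set P0 c. measure_pmf.expectation P f) = measure_pmf.expectation Q f"
    using Q le by (intro cSup_eq_maximum) auto
  ultimately show thesis by (rule that)
qed

end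

theory Submission
  imports Defs
begin

text \<open>
  Since \<open>c < 1 / (1 - p\<^bsub>0s\<^esub>)\<close> for all \<open>s\<close>, the sign constraints in the set of priors never
  bind, so the extreme expectations of \<open>f\<close> are \<open>\<bbbE>\<^sub>0 f \<plusminus> sqrt (c - 1) * \<S>\<^sub>0 f\<close>. Hence the criterion
  equals \<open>\<bbbE>\<^sub>0 f - \<delta> * \<S>\<^sub>0 f\<close>, which is the worst case over the smaller prior set with bound
  \<open>1 + \<delta>\<^sup>2\<close>: the problem is one of pure ambiguity aversion, with strictly positive priors.
  The worst-case expectation of \<open>u'(W) (S - \<pi>)\<close> then controls on which side of a position the
  optimum lies, and strict concavity of \<open>u\<close> makes the criterion strictly quasiconcave. Statements
  about short positions follow from those about long ones by replacing \<open>(S, \<pi>, \<theta>)\<close> with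
  \<open>(-S, -\<pi>, -\<theta>)\<close>, which does not change the wealth.
\<close>

section \<open>Chi-square balls of priors\<close>

text \<open>Each term is split with the factor \<open>sqrt (w i)\<close>. With \<open>w\<close> the
  reference prior, it pairs the chi-square distance of a prior with the variance of a
  payoff.\<close>

lemma weighted_Cauchy_Schwarz:
  fixes x y w :: "'a \<Rightarrow> real"
  assumes "\<And>i. i \<in> I \<Longrightarrow> w i > 0"
  shows "(\<Sum>i\<in>I. x i * y i)\<^sup>2 \<le> (\<Sum>i\<in>I. (x i)\<^sup>2 / w i) * (\<Sum>i\<in>I. w i * (y i)\<^sup>2)"
proof -
  have "(\<Sum>i\<in>I. x i * y i) = (\<Sum>i\<in>I. (x i / sqrt (w i)) * (sqrt (w i) * y i))"
    using assms by (intro sum.cong) (auto dest!: assms)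
  moreover have "(\<Sum>i\<in>I. (x i)\<^sup>2 / w i) = (\<Sum>i\<in>I. (x i / sqrt (w i))\<^sup>2)"
    using assms by (intro sum.cong) (auto simp: power_divide less_imp_le)
  moreover have "(\<Sum>i\<in>I. w i * (y i)\<^sup>2) = (\<Sum>i\<in>I. (sqrt (w i) * y i)\<^sup>2)"
    using assms by (intro sum.cong) (auto simp: power_mult_distrib less_imp_le)
  ultimately show ?thesis
    by (simp only: Cauchy_Schwarz_ineq_sum)
qed

section \<open>Moments on a finite state space\<close>

lemma variance_pmf_finite:
  fixes P :: "'d::finite pmf" and f :: "'d \<Rightarrow> real"
  shows "measure_pmf.variance P f = (\<Sum>s\<in>UNIV. pmf P s * (f s - measure_pmf.expectation P f)\<^sup>2)"
  by (rule expectation_pmf_finite)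

lemma std_dev_nonneg: "0 \<le> std_dev P f"
  by (simp add: std_dev_def)

lemma std_dev_square:
  fixes P :: "'d::finite pmf"
  shows "(std_dev P f)\<^sup>2 = (\<Sum>s\<in>UNIV. pmf P s * (f s - measure_pmf.expectation P f)\<^sup>2)"
  unfolding std_dev_def variance_pmf_finite by (simp add: sum_nonneg)

lemma std_dev_uminus: "std_dev P (\<lambda>s. - f s) = std_dev P f"
proof -
  have "(- f s + x)\<^sup>2 = (f s - x)\<^sup>2" for s x
    by (simp add: power2_commute)
  then show ?thesis
    by (simp add: std_dev_def)
qed

lemma sum_pmf_UNIV: "(\<Sum>s\<in>UNIV. pmf (P :: 'd::finite pmf) s) = 1"
  by (rule sum_pmf_eq_1) auto

lemma sum_pmf_others:
  fixes P :: "'d::finite pmf"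
  shows "(\<Sum>t\<in>UNIV-{s}. pmf P t) = 1 - pmf P s"
  using sum_pmf_UNIV[of P] sum.remove[of UNIV s "pmf P"] by simp

lemma sum_pmf_deviation:
  fixes P :: "'d::finite pmf"
  shows "(\<Sum>s\<in>UNIV. pmf P s * (f s - m)) = measure_pmf.expectation P f - m"
  by (simp add: right_diff_distrib sum_subtractf sum_distrib_right[symmetric] sum_pmf_UNIV
      expectation_pmf_finite)

section \<open>Extreme expectations over a chi-square ball\<close>

locale reference_prior =
  fixes P0 :: "'d::finite pmf" and b :: real
  assumes full_support: "pmf P0 s > 0"
    and nondegenerate: "pmf P0 s < 1"
    and bound_ge_1: "1 \<le> b"
    and bound_small: "b * (1 - pmf P0 s) < 1"
begin

abbreviation mean0 :: "('d \<Rightarrow> real) \<Rightarrow> real" where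
  "mean0 \<equiv> measure_pmf.expectation P0"

text \<open>A prior that misses \<open>s\<close> puts mass 1 on the other states. Cauchy-Schwarz
  there pushes its chi-square sum up to at least \<open>1 / (1 - pmf P0 s)\<close>, which is beyond
  \<open>b\<close>.\<close>

lemma prior_pos:
  assumes "P \<in> prior_set P0 b"
  shows "pmf P s > 0"
proof (rule ccontr)
  assume "\<not> pmf P s > 0"
  then have 0: "pmf P s = 0"
    by (simp add: less_le)
  let ?I = "UNIV - {s}"
  have "1 = (\<Sum>t\<in>?I. pmf P t * 1)\<^sup>2"
    by (simp add: sum_pmf_others 0)
  also have "\<dots> \<le> (\<Sum>t\<in>?I. (pmf P t)\<^sup>2 / pmf P0 t) * (\<Sum>t\<in>?I. pmf P0 t * 1\<^sup>2)"
    by (rule weighted_Cauchy_Schwarz) (rule full_support)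
  also have "\<dots> = (\<Sum>t\<in>?I. (pmf P t)\<^sup>2 / pmf P0 t) * (1 - pmf P0 s)"
    by (simp add: sum_pmf_others)
  also have "(\<Sum>t\<in>?I. (pmf P t)\<^sup>2 / pmf P0 t) = (\<Sum>t\<in>UNIV. (pmf P t)\<^sup>2 / pmf P0 t)"
    by (subst (2) sum.remove[of _ s]) (simp_all add: 0)
  also have "\<dots> * (1 - pmf P0 s) \<le> b * (1 - pmf P0 s)"
    using assms nondegenerate[of s] by (intro mult_right_mono) (auto simp: prior_set_def)
  finally show False
    using bound_small[of s] by simp
qed

text \<open>Exhibits the constraint as a ball of squared radius \<open>b - 1\<close> around
  \<open>P0\<close>.\<close>

lemma sum_square_deviation:
  "(\<Sum>s\<in>UNIV. (pmf P s - pmf P0 s)\<^sup>2 / pmf P0 s) = (\<Sum>s\<in>UNIV. (pmf P s)\<^sup>2 / pmf P0 s) - 1"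
proof -
  have "(pmf P s - pmf P0 s)\<^sup>2 / pmf P0 s = (pmf P s)\<^sup>2 / pmf P0 s - 2 * pmf P s + pmf P0 s" for s
    using full_support[of s] by (simp add: power2_diff add_divide_distrib diff_divide_distrib)
      (simp add: power2_eq_square)
  then show ?thesis
    by (simp add: sum.distrib sum_subtractf sum_distrib_left[symmetric] sum_pmf_UNIV)
qed

lemma prior_expectation_ge:
  assumes "P \<in> prior_set P0 b"
  shows "mean0 f - sqrt (b - 1) * std_dev P0 f \<le> measure_pmf.expectation P f"
proof -
  let ?m = "mean0 f"
  have "(\<Sum>s\<in>UNIV. (pmf P s - pmf P0 s) * (f s - ?m)) =
      (\<Sum>s\<in>UNIV. pmf P s * (f s - ?m)) - (\<Sum>s\<in>UNIV. pmf P0 s * (f s - ?m))"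
    by (simp only: left_diff_distrib sum_subtractf)
  then have eq: "(\<Sum>s\<in>UNIV. (pmf P s - pmf P0 s) * (f s - ?m)) = measure_pmf.expectation P f - ?m"
    by (simp add: sum_pmf_deviation)
  have "(measure_pmf.expectation P f - ?m)\<^sup>2 \<le>
      (\<Sum>s\<in>UNIV. (pmf P s - pmf P0 s)\<^sup>2 / pmf P0 s) * (std_dev P0 f)\<^sup>2"
    unfolding eq[symmetric] std_dev_square
    by (rule weighted_Cauchy_Schwarz) (rule full_support)
  also have "\<dots> \<le> (b - 1) * (std_dev P0 f)\<^sup>2"
    using assms by (intro mult_right_mono) (auto simp: sum_square_deviation prior_set_def)
  also have "\<dots> = (sqrt (b - 1) * std_dev P0 f)\<^sup>2"
    using bound_ge_1 by (simp add: power_mult_distrib)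
  finally have "\<bar>measure_pmf.expectation P f - ?m\<bar> \<le> \<bar>sqrt (b - 1) * std_dev P0 f\<bar>"
    by (simp only: abs_le_square_iff)
  moreover have "0 \<le> sqrt (b - 1) * std_dev P0 f"
    using bound_ge_1 by (simp add: std_dev_nonneg)
  ultimately show ?thesis
    by linarith
qed

text \<open>This keeps the candidate minimizer nonnegative. Since deviations average to zero, the
  one at \<open>s\<close> is balanced by the other states. Cauchy-Schwarz on those bounds it by the
  variance, and \<open>bound_small\<close> gives \<open>(1 - p) * (b - 1) \<le> p\<close> for
  \<open>p = pmf P0 s\<close>.\<close>

lemma deviation_le:
  "(b - 1) * (f s - mean0 f)\<^sup>2 \<le> (std_dev P0 f)\<^sup>2"
proof -
  let ?m = "mean0 f" and ?p = "pmf P0 s" and ?I = "UNIV - {s}"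
  let ?R = "\<Sum>t\<in>?I. pmf P0 t * (f t - ?m)\<^sup>2"
  have q: "0 < 1 - ?p" "0 < ?p"
    using nondegenerate[of s] full_support[of s] by auto
  have "(\<Sum>t\<in>UNIV. pmf P0 t * (f t - ?m)) = 0"
    by (simp add: sum_pmf_deviation)
  then have "(\<Sum>t\<in>?I. pmf P0 t * (f t - ?m)) = - (?p * (f s - ?m))"
    by (subst (asm) sum.remove[of _ s]) (auto simp: sum_pmf_UNIV)
  then have "?p\<^sup>2 * (f s - ?m)\<^sup>2 = (\<Sum>t\<in>?I. pmf P0 t * (f t - ?m))\<^sup>2"
    by (simp add: power_mult_distrib)
  also have "\<dots> \<le> (\<Sum>t\<in>?I. (pmf P0 t)\<^sup>2 / pmf P0 t) * ?R"
    by (rule weighted_Cauchy_Schwarz) (rule full_support)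
  also have "(\<Sum>t\<in>?I. (pmf P0 t)\<^sup>2 / pmf P0 t) = 1 - ?p"
    using full_support by (simp add: power2_eq_square less_imp_neq[symmetric] sum_pmf_others)
  finally have R: "?p\<^sup>2 * (f s - ?m)\<^sup>2 \<le> (1 - ?p) * ?R" .
  have var: "(std_dev P0 f)\<^sup>2 = ?p * (f s - ?m)\<^sup>2 + ?R"
    unfolding std_dev_square by (subst sum.remove[of _ s]) auto
  have "?p * (f s - ?m)\<^sup>2 = (1 - ?p) * (?p * (f s - ?m)\<^sup>2) + ?p\<^sup>2 * (f s - ?m)\<^sup>2"
    by (simp add: algebra_simps power2_eq_square)
  also have "\<dots> \<le> (1 - ?p) * (std_dev P0 f)\<^sup>2"
    using R by (simp add: var algebra_simps)
  finally have *: "?p * (f s - ?m)\<^sup>2 \<le> (1 - ?p) * (std_dev P0 f)\<^sup>2" .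
  have "(1 - ?p) * (b - 1) * (f s - ?m)\<^sup>2 \<le> ?p * (f s - ?m)\<^sup>2"
    using bound_small[of s] by (intro mult_right_mono) (auto simp: algebra_simps)
  with * have "(1 - ?p) * ((b - 1) * (f s - ?m)\<^sup>2) \<le> (1 - ?p) * (std_dev P0 f)\<^sup>2"
    by simp
  then show ?thesis
    using q by simp
qed

lemma prior_expectation_attained:
  "\<exists>Q\<in>prior_set P0 b. measure_pmf.expectation Q f = mean0 f - sqrt (b - 1) * std_dev P0 f"
proof (cases "std_dev P0 f = 0")
  case True
  then show ?thesis
    using prior_set_nonempty[OF full_support bound_ge_1] by auto
next
  case False
  let ?m = "mean0 f" and ?\<sigma> = "std_dev P0 f" and ?r = "sqrt (b - 1)"
  have \<sigma>: "?\<sigma> > 0"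
    using False std_dev_nonneg[of P0 f] by simp
  \<comment> \<open>The equality case of Cauchy-Schwarz: \<open>P0\<close> is tilted against the
    centered \<open>f\<close>, scaled so that the result lies on the boundary of the ball.\<close>
  define q where "q = (\<lambda>s. pmf P0 s * (1 - ?r * (f s - ?m) / ?\<sigma>))"
  have centered: "(\<Sum>s\<in>UNIV. pmf P0 s * (f s - ?m)) = 0"
    by (simp add: sum_pmf_deviation)
  have q_alt: "q s = pmf P0 s - (?r / ?\<sigma>) * (pmf P0 s * (f s - ?m))" for s
    by (simp add: q_def right_diff_distrib diff_divide_distrib mult.left_commute)
  have q_nonneg: "0 \<le> q s" for s
  proof -
    have "(?r * (f s - ?m))\<^sup>2 \<le> ?\<sigma>\<^sup>2"
      using deviation_le[of f s] bound_ge_1 by (simp add: power_mult_distrib)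
    then have "?r * (f s - ?m) \<le> ?\<sigma>"
      by (rule power2_le_imp_le) (use \<sigma> in simp)
    then show ?thesis
      using \<sigma> by (simp add: q_def)
  qed
  have q_sum: "(\<Sum>s\<in>UNIV. q s) = 1"
    unfolding q_alt sum_subtractf sum_distrib_left[symmetric] centered by (simp add: sum_pmf_UNIV)
  obtain Q where Q: "\<And>s. pmf Q s = q s"
    using pmf_vec_ex[of "\<chi> s. q s"] q_nonneg q_sum by auto
  have "(\<Sum>s\<in>UNIV. (pmf Q s - pmf P0 s)\<^sup>2 / pmf P0 s) =
      (\<Sum>s\<in>UNIV. (?r / ?\<sigma>)\<^sup>2 * (pmf P0 s * (f s - ?m)\<^sup>2))"
    using full_support
    by (intro sum.cong) (auto simp: Q q_alt power2_eq_square less_imp_neq[symmetric])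
  also have "\<dots> = b - 1"
    unfolding sum_distrib_left[symmetric] std_dev_square[symmetric]
    using \<sigma> bound_ge_1 by (simp add: power_divide)
  finally have "Q \<in> prior_set P0 b"
    by (simp add: sum_square_deviation prior_set_def)
  moreover have "measure_pmf.expectation Q f = ?m - ?r * ?\<sigma>"
  proof -
    have "pmf P0 s * (f s - ?m) * f s =
        pmf P0 s * (f s - ?m)\<^sup>2 + ?m * (pmf P0 s * (f s - ?m))" for s
      by (simp add: algebra_simps power2_eq_square)
    then have "(\<Sum>s\<in>UNIV. pmf P0 s * (f s - ?m) * f s) = ?\<sigma>\<^sup>2"
      by (simp add: sum.distrib std_dev_square sum_distrib_left[symmetric] centered)
    moreover have "measure_pmf.expectation Q f =
        ?m - (?r / ?\<sigma>) * (\<Sum>s\<in>UNIV. pmf P0 s * (f s - ?m) * f s)"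
      unfolding expectation_pmf_finite[of Q] Q q_alt
      by (simp only: left_diff_distrib sum_subtractf expectation_pmf_finite[of P0 f, symmetric]
          sum_distrib_left mult.assoc)
    ultimately show ?thesis
      using \<sigma> by (simp add: power2_eq_square)
  qed
  ultimately show ?thesis
    by blast
qed

lemma INF_prior_set:
  "(INF P\<in>prior_set P0 b. measure_pmf.expectation P f) = mean0 f - sqrt (b - 1) * std_dev P0 f"
proof (intro cInf_eq_minimum)
  show "mean0 f - sqrt (b - 1) * std_dev P0 f \<in>
      (\<lambda>P. measure_pmf.expectation P f) ` prior_set P0 b"
    using prior_expectation_attained[of f] by force
qed (auto intro: prior_expectation_ge)

lemma SUP_prior_set:
  "(SUP P\<in>prior_set P0 b. measure_pmf.expectation P f) = mean0 f + sqrt (b - 1) * std_dev P0 f"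
proof (intro cSup_eq_maximum)
  show "mean0 f + sqrt (b - 1) * std_dev P0 f \<in>
      (\<lambda>P. measure_pmf.expectation P f) ` prior_set P0 b"
    using prior_expectation_attained[of "\<lambda>s. - f s"] by (force simp: std_dev_uminus)
next
  fix x assume "x \<in> (\<lambda>P. measure_pmf.expectation P f) ` prior_set P0 b"
  then show "x \<le> mean0 f + sqrt (b - 1) * std_dev P0 f"
    using prior_expectation_ge[of _ "\<lambda>s. - f s"] by (force simp: std_dev_uminus)
qed

end

section \<open>The worst-case investor\<close>

text \<open>An abstract upward closed domain covers both utility cases at once. The lower Inada
  condition is phrased through points of \<open>A\<close> instead of a limit, so it reads the same
  for the end at minus infinity and the end at 0.\<close>

locale inada_utility =
  fixes A :: "real set" and u u' :: "real \<Rightarrow> real"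
  assumes open_dom: "open A"
    and up_closed: "x \<in> A \<Longrightarrow> x \<le> y \<Longrightarrow> y \<in> A"
    and u_deriv: "x \<in> A \<Longrightarrow> (u has_real_derivative u' x) (at x)"
    and u'_continuous: "x \<in> A \<Longrightarrow> isCont u' x"
    and u_concave: "strictly_concave_on A u"
    and u'_unbounded: "x \<in> A \<Longrightarrow> \<exists>y\<in>A. y < x \<and> B < u' y"
    and u'_vanishing: "(u' \<longlongrightarrow> 0) at_top"
begin

lemma convex_dom: "convex A"
  using u_concave unfolding strictly_concave_on_def by blast

text \<open>The tangent bound for the convex function \<open>- u\<close>. Later estimates of utility
  by marginal utility rest on it.\<close>

lemma u_le_tangent:
  assumes "x \<in> A" "y \<in> A"
  shows "u y \<le> u x + u' x * (y - x)"
proof -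
  have "convex_on A (\<lambda>x. - u x)"
  proof (rule convex_onI)
    show "convex A"
      by (rule convex_dom)
    fix t x y :: real
    assume t: "0 < t" "t < 1" and xy: "x \<in> A" "y \<in> A"
    have "(1 - t) * u x + t * u y \<le> u ((1 - t) * x + t * y)"
    proof (cases "x = y")
      case True
      then show ?thesis
        by (simp add: left_diff_distrib)
    next
      case False
      then have "(1 - t) * u x + t * u y < u ((1 - t) * x + t * y)"
        using u_concave t xy unfolding strictly_concave_on_def by blast
      then show ?thesis
        by simp
    qed
    then show "- u ((1 - t) *\<^sub>R x + t *\<^sub>R y) \<le> (1 - t) * - u x + t * - u y"
      by simp
  qed
  moreover have "connected A"
    by (rule convex_connected) (rule convex_dom)
  moreover have "x \<in> interior A"
    using assms open_dom by (simp add: interior_open)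
  moreover have "((\<lambda>x. - u x) has_real_derivative - u' x) (at x within A)"
    by (rule has_field_derivative_at_within[OF DERIV_minus[OF u_deriv[OF assms(1)]]])
  ultimately have "- u y - - u x \<ge> - u' x * (y - x)"
    using assms(2) by (intro convex_on_imp_above_tangent[where A = A and f = "\<lambda>x. - u x"])
  then show ?thesis
    by simp
qed

lemma u'_antimono:
  assumes "x \<in> A" "x \<le> y"
  shows "u' y \<le> u' x"
proof -
  have "y \<in> A"
    using assms up_closed by blast
  then have "0 \<le> (u' x - u' y) * (y - x)"
    using u_le_tangent[of x y] u_le_tangent[of y x] assms(1) by (simp add: algebra_simps)
  then show ?thesis
    using assms(2) by (cases "x = y") (auto simp: zero_le_mult_iff)
qed

text \<open>A decreasing marginal utility with limit 0 is nonnegative. If it vanished at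
  \<open>x\<close>, then \<open>u (x + 1 / 2) \<le> u x \<le> u (x + 1)\<close>, against strict
  concavity at the midpoint.\<close>

lemma u'_pos:
  assumes "x \<in> A"
  shows "0 < u' x"
proof -
  have nonneg: "0 \<le> u' y" if "y \<in> A" for y
  proof (rule tendsto_upperbound[OF u'_vanishing])
    show "\<forall>\<^sub>F z in at_top. u' z \<le> u' y"
      using eventually_ge_at_top[of y] by (rule eventually_mono) (rule u'_antimono[OF that])
  qed simp
  have A: "x + 1 \<in> A" "x + 1 / 2 \<in> A"
    using up_closed[OF assms] by auto
  have "u' x \<noteq> 0"
  proof
    assume "u' x = 0"
    then have "u (x + 1 / 2) \<le> u x"
      using u_le_tangent[OF assms A(2)] by simp
    moreover have "u x \<le> u (x + 1)"
      using u_le_tangent[OF A(1) assms] nonneg[OF A(1)] by simp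
    moreover have "x \<noteq> x + 1 \<and> (0::real) < 1 / 2 \<and> (1 / 2::real) < 1"
      by simp
    then have "(1 - 1 / 2) * u x + 1 / 2 * u (x + 1) < u ((1 - 1 / 2) * x + 1 / 2 * (x + 1))"
      using u_concave assms A(1) unfolding strictly_concave_on_def by blast
    moreover have "(1 - 1 / 2) * x + 1 / 2 * (x + 1) = x + 1 / 2"
      by (simp add: field_simps)
    ultimately show False
      by simp
  qed
  then show ?thesis
    using nonneg[OF assms] by simp
qed

end

lemma inada_utility_deriv:
  assumes "strictly_concave_on (utility_dom k) u" "twice_differentiable_on (utility_dom k) u"
    and "inada k u"
  shows "inada_utility (utility_dom k) u (deriv u)"
proof
  show "open (utility_dom k)"
    by (cases k) auto
  show "y \<in> utility_dom k" if "x \<in> utility_dom k" "x \<le> y" for x y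
    using that by (cases k) auto
  show "(u has_real_derivative deriv u x) (at x)" if "x \<in> utility_dom k" for x
    using that assms(2)
    by (auto simp: twice_differentiable_on_def DERIV_deriv_iff_real_differentiable)
  show "isCont (deriv u) x" if "x \<in> utility_dom k" for x
    using that assms(2)
    by (auto simp: twice_differentiable_on_def intro: differentiable_imp_continuous_within)
  show "(deriv u \<longlongrightarrow> 0) at_top"
    using assms(3) by (simp add: inada_def)
  show "\<exists>y\<in>utility_dom k. y < x \<and> B < deriv u y" if x: "x \<in> utility_dom k" for x B
  proof -
    have B: "\<forall>\<^sub>F y in lower_end k. B < deriv u y"
      using assms(3) by (auto simp: inada_def filterlim_at_top_dense)
    have "\<forall>\<^sub>F y in lower_end k. y \<in> utility_dom k \<and> y < x"
    proof (cases k)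
      case Whole_Line
      then show ?thesis
        by (simp add: eventually_gt_at_bot eventually_at_bot_dense)
    next
      case Positive_Half_Line
      then show ?thesis
        using eventually_at_right_real[of 0 x] x by simp
    qed
    moreover have "lower_end k \<noteq> bot"
      by (cases k) auto
    ultimately show ?thesis
      using eventually_happens'[OF _ eventually_conj[OF B]] by blast
  qed
qed (rule assms(1))

section \<open>Reflection of positions and absence of arbitrage\<close>

lemma wealth_uminus: "wealth w0 (\<lambda>s. - S s) (- \<pi>) (- \<theta>) = wealth w0 S \<pi> \<theta>"
  by (simp add: wealth_def fun_eq_iff algebra_simps)

definition no_arbitrage :: "('d \<Rightarrow> real) \<Rightarrow> real \<Rightarrow> bool" where
  "no_arbitrage S \<pi> \<longleftrightarrow> (\<exists>s. S s < \<pi>) \<and> (\<exists>s. \<pi> < S s)"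

lemma no_arbitrage_uminus: "no_arbitrage (\<lambda>s. - S s) (- \<pi>) \<longleftrightarrow> no_arbitrage S \<pi>"
  by (auto simp: no_arbitrage_def)

text \<open>The set \<open>K\<close> is kept abstract: what is retained of a chi-square ball is that
  minima are attained and that every prior charges every state.\<close>

locale robust_investor = inada_utility A u u'
  for A :: "real set" and u u' :: "real \<Rightarrow> real" +
  fixes K :: "'d::finite pmf set" and w0 :: real
  assumes min_attained: "\<exists>Q\<in>K. \<forall>P\<in>K. measure_pmf.expectation Q (f :: 'd \<Rightarrow> real) \<le>
        measure_pmf.expectation P f"
    and weights_pos: "P \<in> K \<Longrightarrow> pmf P s > 0"
    and w0_dom: "w0 \<in> A"
begin

definition worst :: "('d \<Rightarrow> real) \<Rightarrow> real" where
  "worst f = (INF P\<in>K. measure_pmf.expectation P f)"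

definition feasible :: "('d \<Rightarrow> real) \<Rightarrow> real \<Rightarrow> real set" where
  "feasible S \<pi> = {\<theta>. \<forall>s. wealth w0 S \<pi> \<theta> s \<in> A}"

definition criterion :: "('d \<Rightarrow> real) \<Rightarrow> real \<Rightarrow> real \<Rightarrow> real" where
  "criterion S \<pi> \<theta> = worst (\<lambda>s. u (wealth w0 S \<pi> \<theta> s))"

text \<open>The derivative in \<theta> of expected utility under \<open>P\<close> is the expectation
  of this integrand. Its worst case is a lower bound under every prior, in particular under the one
  that is minimal for the criterion at \<theta>.\<close>

definition slope :: "('d \<Rightarrow> real) \<Rightarrow> real \<Rightarrow> real \<Rightarrow> real" where
  "slope S \<pi> \<theta> = worst (\<lambda>s. u' (wealth w0 S \<pi> \<theta> s) * (S s - \<pi>))"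

definition optimal :: "('d \<Rightarrow> real) \<Rightarrow> real \<Rightarrow> real \<Rightarrow> bool" where
  "optimal S \<pi> \<theta> \<longleftrightarrow>
    \<theta> \<in> feasible S \<pi> \<and> (\<forall>\<theta>'\<in>feasible S \<pi>. criterion S \<pi> \<theta>' \<le> criterion S \<pi> \<theta>)"

definition optimum :: "('d \<Rightarrow> real) \<Rightarrow> real \<Rightarrow> real" where
  "optimum S \<pi> = (THE \<theta>. optimal S \<pi> \<theta>)"

lemma feasible_uminus: "- \<theta> \<in> feasible (\<lambda>s. - S s) (- \<pi>) \<longleftrightarrow> \<theta> \<in> feasible S \<pi>"
  by (simp add: feasible_def wealth_uminus)

lemma criterion_uminus: "criterion (\<lambda>s. - S s) (- \<pi>) (- \<theta>) = criterion S \<pi> \<theta>"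
  by (simp add: criterion_def wealth_uminus)

lemma optimal_uminus: "optimal (\<lambda>s. - S s) (- \<pi>) (- \<theta>) \<longleftrightarrow> optimal S \<pi> \<theta>"
proof -
  have "(\<forall>\<theta>'\<in>feasible (\<lambda>s. - S s) (- \<pi>). criterion (\<lambda>s. - S s) (- \<pi>) \<theta>' \<le> x) \<longleftrightarrow>
      (\<forall>\<theta>'\<in>feasible S \<pi>. criterion S \<pi> \<theta>' \<le> x)" for x
    by (metis criterion_uminus feasible_uminus minus_minus)
  then show ?thesis
    by (simp add: optimal_def feasible_uminus criterion_uminus)
qed

section \<open>Continuity of the worst case\<close>

lemma worst_minimizer:
  "\<exists>Q\<in>K. worst f = measure_pmf.expectation Q f \<and> (\<forall>P\<in>K. worst f \<le> measure_pmf.expectation P f)"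
proof -
  obtain Q where Q: "Q \<in> K" "\<forall>P\<in>K. measure_pmf.expectation Q f \<le> measure_pmf.expectation P f"
    using min_attained[of f] by blast
  then have "worst f = measure_pmf.expectation Q f"
    unfolding worst_def by (intro cInf_eq_minimum) auto
  with Q show ?thesis
    by auto
qed

lemma worst_attained:
  obtains Q where "Q \<in> K" "worst f = measure_pmf.expectation Q f"
  using worst_minimizer[of f] by blast

lemma worst_le: "P \<in> K \<Longrightarrow> worst f \<le> measure_pmf.expectation P f"
  using worst_minimizer[of f] by blast

text \<open>The minimizer for \<open>g\<close> is tested on \<open>f\<close>. The resulting
  Lipschitz bound makes pointwise convergence of payoffs enough for convergence of the worst
  case.\<close>

lemma worst_diff_le: "worst f - worst g \<le> (\<Sum>s\<in>UNIV. \<bar>f s - g s\<bar>)"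
proof -
  obtain Q where Q: "Q \<in> K" "worst g = measure_pmf.expectation Q g"
    by (rule worst_attained)
  have "worst f - worst g \<le> (\<Sum>s\<in>UNIV. pmf Q s * (f s - g s))"
    using worst_le[OF Q(1), of f] Q(2)
    by (simp add: expectation_pmf_finite right_diff_distrib sum_subtractf)
  also have "\<dots> \<le> (\<Sum>s\<in>UNIV. 1 * \<bar>f s - g s\<bar>)"
    by (intro sum_mono order_trans[OF mult_left_mono[OF abs_ge_self] mult_right_mono]) (auto simp: pmf_le_1)
  finally show ?thesis
    by simp
qed

lemma tendsto_worst:
  assumes "\<And>s. ((\<lambda>x. f x s) \<longlongrightarrow> g s) F"
  shows "((\<lambda>x. worst (f x)) \<longlongrightarrow> worst g) F"
proof -
  have "((\<lambda>x. worst (f x) - worst g) \<longlongrightarrow> 0) F"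
  proof (rule Lim_null_comparison)
    have "\<bar>worst (f x) - worst g\<bar> \<le> (\<Sum>s\<in>UNIV. \<bar>f x s - g s\<bar>)" for x
      using worst_diff_le[of "f x" g] worst_diff_le[of g "f x"] by (simp add: abs_minus_commute)
    then show "\<forall>\<^sub>F x in F. norm (worst (f x) - worst g) \<le> (\<Sum>s\<in>UNIV. \<bar>f x s - g s\<bar>)"
      by simp
    have "((\<lambda>x. \<Sum>s\<in>UNIV. \<bar>f x s - g s\<bar>) \<longlongrightarrow> (\<Sum>s\<in>UNIV. \<bar>g s - g s\<bar>)) F"
      by (intro tendsto_intros assms)
    then show "((\<lambda>x. \<Sum>s\<in>UNIV. \<bar>f x s - g s\<bar>) \<longlongrightarrow> 0) F"
      by simp
  qed
  then show ?thesis
    by (rule LIM_zero_cancel)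
qed

lemma tendsto_wealth:
  assumes "(p \<longlongrightarrow> \<pi>) F" "(g \<longlongrightarrow> \<theta>) F"
  shows "((\<lambda>x. wealth w0 S (p x) (g x) s) \<longlongrightarrow> wealth w0 S \<pi> \<theta> s) F"
  unfolding wealth_def by (intro tendsto_intros assms)

lemma tendsto_criterion:
  assumes "(p \<longlongrightarrow> \<pi>) F" "(g \<longlongrightarrow> \<theta>) F" "\<theta> \<in> feasible S \<pi>"
  shows "((\<lambda>x. criterion S (p x) (g x)) \<longlongrightarrow> criterion S \<pi> \<theta>) F"
  unfolding criterion_def using assms
  by (intro tendsto_worst isCont_tendsto_compose[OF DERIV_isCont[OF u_deriv]] tendsto_wealth)
    (auto simp: feasible_def)

lemma tendsto_slope:
  assumes "(p \<longlongrightarrow> \<pi>) F" "(g \<longlongrightarrow> \<theta>) F" "\<theta> \<in> feasible S \<pi>"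
  shows "((\<lambda>x. slope S (p x) (g x)) \<longlongrightarrow> slope S \<pi> \<theta>) F"
  unfolding slope_def using assms
  by (intro tendsto_worst tendsto_mult isCont_tendsto_compose[OF u'_continuous] tendsto_wealth
      tendsto_diff tendsto_const)
    (auto simp: feasible_def)

lemma eventually_feasible:
  assumes "(p \<longlongrightarrow> \<pi>) F" "(g \<longlongrightarrow> \<theta>) F" "\<theta> \<in> feasible S \<pi>"
  shows "\<forall>\<^sub>F x in F. g x \<in> feasible S (p x)"
proof -
  have "\<forall>\<^sub>F x in F. wealth w0 S (p x) (g x) s \<in> A" for s
    using topological_tendstoD[OF tendsto_wealth[OF assms(1,2)] open_dom, of S s] assms(3)
    by (simp add: feasible_def)
  then show ?thesis
    by (simp add: feasible_def eventually_all_finite)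
qed

lemma zero_feasible: "0 \<in> feasible S \<pi>"
  by (simp add: feasible_def wealth_def w0_dom)

text \<open>In each state wealth is monotone in the position, so at \<open>t\<close> it is at least
  the wealth at one of the endpoints, and \<open>A\<close> is upward closed.\<close>

lemma feasible_between:
  assumes "a \<in> feasible S \<pi>" "b \<in> feasible S \<pi>" "a \<le> t" "t \<le> b"
  shows "t \<in> feasible S \<pi>"
  unfolding feasible_def
proof safe
  fix s
  show "wealth w0 S \<pi> t s \<in> A"
  proof (cases "S s \<ge> \<pi>")
    case True
    then have "wealth w0 S \<pi> a s \<le> wealth w0 S \<pi> t s"
      using assms(3) by (simp add: wealth_def mult_right_mono)
    then show ?thesis
      using assms(1) up_closed by (auto simp: feasible_def)
  next
    case False
    then have "wealth w0 S \<pi> b s \<le> wealth w0 S \<pi> t s"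
      using assms(4) by (simp add: wealth_def mult_right_mono_neg)
    then show ?thesis
      using assms(2) up_closed by (auto simp: feasible_def)
  qed
qed

section \<open>Shape of the criterion and location of the optimum\<close>

lemma criterion_strictly_quasiconcave:
  assumes "a \<in> feasible S \<pi>" "b \<in> feasible S \<pi>" "a < t" "t < b" "no_arbitrage S \<pi>"
  shows "min (criterion S \<pi> a) (criterion S \<pi> b) < criterion S \<pi> t"
proof -
  let ?W = "wealth w0 S \<pi>"
  define r where "r = (t - a) / (b - a)"
  have r: "0 < r" "r < 1"
    using assms(3,4) by (auto simp: r_def)
  have "r * (b - a) = t - a"
    using assms(3,4) by (simp add: r_def)
  then have t: "t = (1 - r) * a + r * b"
    by (simp add: algebra_simps)
  have W: "?W t s = (1 - r) * ?W a s + r * ?W b s" for s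
    by (simp add: t wealth_def algebra_simps)
  have strict: "(1 - r) * u (?W a s) + r * u (?W b s) < u (?W t s)" if "S s \<noteq> \<pi>" for s
  proof -
    have "?W a s \<noteq> ?W b s"
      using that assms(3,4) by (simp add: wealth_def)
    then show ?thesis
      using u_concave r assms(1,2) unfolding strictly_concave_on_def W feasible_def by blast
  qed
  have weak: "(1 - r) * u (?W a s) + r * u (?W b s) \<le> u (?W t s)" for s
  proof (cases "S s = \<pi>")
    case True
    then show ?thesis
      by (simp add: wealth_def algebra_simps)
  qed (use strict in \<open>auto intro: less_imp_le\<close>)
  \<comment> \<open>The prior that is worst at \<open>t\<close> bounds the criterion at
    \<open>a\<close> and at \<open>b\<close> from above, so all three positions can be compared
    under it. Strictness comes from the state \<open>s0\<close> below, which has positive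
    weight.\<close>
  obtain Q where Q: "Q \<in> K" "criterion S \<pi> t = measure_pmf.expectation Q (\<lambda>s. u (?W t s))"
    unfolding criterion_def by (rule worst_attained)
  obtain s0 where s0: "S s0 \<noteq> \<pi>"
    using assms(5) unfolding no_arbitrage_def by (metis less_irrefl)
  have "min (criterion S \<pi> a) (criterion S \<pi> b) \<le>
      (1 - r) * criterion S \<pi> a + r * criterion S \<pi> b"
    using r convex_bound_le[of "- criterion S \<pi> a" "- min (criterion S \<pi> a) (criterion S \<pi> b)"
        "- criterion S \<pi> b" "1 - r" r]
    by simp
  also have "\<dots> \<le> (1 - r) * measure_pmf.expectation Q (\<lambda>s. u (?W a s)) +
      r * measure_pmf.expectation Q (\<lambda>s. u (?W b s))"
    unfolding criterion_def using r Q(1) by (intro add_mono mult_left_mono worst_le) auto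
  also have "\<dots> = (\<Sum>s\<in>UNIV. pmf Q s * ((1 - r) * u (?W a s) + r * u (?W b s)))"
    by (simp add: expectation_pmf_finite sum_distrib_left sum.distrib[symmetric] algebra_simps)
  also have "\<dots> < (\<Sum>s\<in>UNIV. pmf Q s * u (?W t s))"
  proof (rule sum_strict_mono_ex1)
    show "\<exists>s\<in>UNIV. pmf Q s * ((1 - r) * u (?W a s) + r * u (?W b s)) < pmf Q s * u (?W t s)"
      using strict[OF s0] weights_pos[OF Q(1)] by (intro bexI[of _ s0] mult_strict_left_mono) auto
  qed (auto intro!: mult_left_mono weak)
  also have "\<dots> = criterion S \<pi> t"
    by (simp add: Q(2) expectation_pmf_finite)
  finally show ?thesis .
qed

text \<open>If the optimum lay beyond \<open>a\<close> or \<open>b\<close>, that endpoint would lie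
  between it and \<open>m\<close> while having a smaller value than both, against
  quasiconcavity.\<close>

lemma optimal_between:
  assumes "optimal S \<pi> t" "no_arbitrage S \<pi>" "a < m" "m < b"
    and "a \<in> feasible S \<pi>" "b \<in> feasible S \<pi>"
    and "criterion S \<pi> a < criterion S \<pi> m" "criterion S \<pi> b < criterion S \<pi> m"
  shows "a < t \<and> t < b"
proof -
  have m: "m \<in> feasible S \<pi>"
    using feasible_between[OF assms(5,6)] assms(3,4) by simp
  then have t: "criterion S \<pi> m \<le> criterion S \<pi> t" "t \<in> feasible S \<pi>"
    using assms(1) by (auto simp: optimal_def)
  have "\<not> t < a"
    using criterion_strictly_quasiconcave[OF t(2) m _ assms(3,2)] assms(7) t(1) by auto
  moreover have "\<not> b < t"
    using criterion_strictly_quasiconcave[OF m t(2) assms(4) _ assms(2)] assms(8) t(1) by auto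
  moreover have "t \<noteq> a" "t \<noteq> b"
    using t(1) assms(7,8) by auto
  ultimately show ?thesis
    by linarith
qed

text \<open>Under the prior that is worst at \<theta>, tangents at \<theta> bound the change of the
  criterion by \<open>\<theta>' - \<theta>\<close> times an expectation that is at least the slope.
  Hence a positive slope rules out everything to the left.\<close>

lemma criterion_less_if_slope_pos:
  assumes "\<theta> \<in> feasible S \<pi>" "0 < slope S \<pi> \<theta>" "\<theta>' \<in> feasible S \<pi>" "\<theta>' < \<theta>"
  shows "criterion S \<pi> \<theta>' < criterion S \<pi> \<theta>"
proof -
  let ?W = "wealth w0 S \<pi>"
  obtain Q where Q: "Q \<in> K" "criterion S \<pi> \<theta> = measure_pmf.expectation Q (\<lambda>s. u (?W \<theta> s))"
    unfolding criterion_def by (rule worst_attained)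
  let ?g = "\<Sum>s\<in>UNIV. pmf Q s * (u' (?W \<theta> s) * (S s - \<pi>))"
  have "criterion S \<pi> \<theta>' \<le> (\<Sum>s\<in>UNIV. pmf Q s * u (?W \<theta>' s))"
    unfolding criterion_def using worst_le[OF Q(1)] by (simp add: expectation_pmf_finite)
  also have "\<dots> \<le> (\<Sum>s\<in>UNIV. pmf Q s * (u (?W \<theta> s) + u' (?W \<theta> s) * (?W \<theta>' s - ?W \<theta> s)))"
    using assms(1,3) by (intro sum_mono mult_left_mono u_le_tangent) (auto simp: feasible_def)
  also have "\<dots> = criterion S \<pi> \<theta> + (\<theta>' - \<theta>) * ?g"
    by (simp add: Q(2) expectation_pmf_finite sum_distrib_left sum.distrib[symmetric] wealth_def
        algebra_simps)
  also have "\<dots> < criterion S \<pi> \<theta>"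
  proof -
    have "0 < ?g"
      using assms(2) worst_le[OF Q(1)] unfolding slope_def expectation_pmf_finite
      by (rule less_le_trans)
    then show ?thesis
      using assms(4) by (simp add: mult_neg_pos)
  qed
  finally show ?thesis .
qed

lemma optimal_ge_if_slope_pos:
  assumes "optimal S \<pi> t" "\<theta> \<in> feasible S \<pi>" "0 < slope S \<pi> \<theta>"
  shows "\<theta> \<le> t"
  using criterion_less_if_slope_pos[OF assms(2,3), of t] assms(1,2)
  by (force simp: optimal_def)

text \<open>The mass of \<open>s\<close> is the expectation of an indicator, so its minimum over
  \<open>K\<close> is attained and therefore positive.\<close>

lemma worst_pos_weight:
  obtains \<eta> where "0 < \<eta>" "\<And>P. P \<in> K \<Longrightarrow> \<eta> \<le> pmf P s"
proof -
  have eq: "measure_pmf.expectation P (indicator {s}) = pmf P s" for P :: "'d pmf"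
    by (simp add: pmf.rep_eq)
  obtain Q where "Q \<in> K" "worst (indicator {s}) = measure_pmf.expectation Q (indicator {s})"
    by (rule worst_attained)
  then have "0 < worst (indicator {s})"
    using weights_pos by (simp only: eq)
  then show thesis
    using that worst_le[of _ "indicator {s}"] by (simp only: eq)
qed

text \<open>
  Going short far enough drives the wealth in the state with the highest payoff to the lower end of
  the domain of \<open>u\<close>, where the exploding marginal utility outweighs all other states.
\<close>

lemma ex_slope_pos:
  assumes "no_arbitrage S \<pi>"
  obtains \<theta> where "\<theta> \<in> feasible S \<pi>" "0 < slope S \<pi> \<theta>"
proof -
  let ?W = "wealth w0 S \<pi>"
  obtain h where h: "\<And>s. S s \<le> S h"
  proof -
    have "Max (range S) \<in> range S"
      by (rule Max_in) auto
    then obtain h where "Max (range S) = S h"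
      by blast
    then show thesis
      using that[of h] by (metis Max_ge finite finite_imageI rangeI)
  qed
  then have gap: "0 < S h - \<pi>"
    using assms by (auto simp: no_arbitrage_def intro: less_le_trans)
  obtain \<eta> where \<eta>: "0 < \<eta>" "\<And>P. P \<in> K \<Longrightarrow> \<eta> \<le> pmf P h"
    using worst_pos_weight[of h] by blast
  \<comment> \<open>\<open>C\<close> bounds the total loss from states paying less than \<pi>: for a
    short position their wealth is at least \<open>w0\<close>, so their marginal utility is at most
    \<open>u' w0\<close>.\<close>
  define C where "C = (\<Sum>s\<in>UNIV. u' w0 * \<bar>S s - \<pi>\<bar>)"
  obtain x where x: "x \<in> A" "x < w0" "C / (\<eta> * (S h - \<pi>)) < u' x"
    using u'_unbounded[OF w0_dom] by blast
  \<comment> \<open>The position whose wealth in the top state \<open>h\<close> is exactly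
    \<open>x\<close>. There, by the choice of \<open>x\<close>, even the minimal weight
    \<open>\<eta>\<close> yields a gain exceeding \<open>C\<close>.\<close>
  define \<theta> where "\<theta> = (x - w0) / (S h - \<pi>)"
  have \<theta>: "\<theta> \<le> 0"
    using x gap by (simp add: \<theta>_def divide_nonpos_pos)
  have Wh: "?W \<theta> h = x"
    using gap by (simp add: wealth_def \<theta>_def)
  have "x \<le> ?W \<theta> s" for s
    using h[of s] \<theta> unfolding Wh[symmetric] by (simp add: wealth_def mult_left_mono_neg)
  then have feas: "\<theta> \<in> feasible S \<pi>"
    using x(1) up_closed by (auto simp: feasible_def)
  have "0 < slope S \<pi> \<theta>"
  proof -
    obtain Q where Q: "Q \<in> K"
        "slope S \<pi> \<theta> = measure_pmf.expectation Q (\<lambda>s. u' (?W \<theta> s) * (S s - \<pi>))"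
      unfolding slope_def by (rule worst_attained)
    have lower: "- (u' w0 * \<bar>S s - \<pi>\<bar>) \<le> pmf Q s * (u' (?W \<theta> s) * (S s - \<pi>))" for s
    proof (cases "S s \<ge> \<pi>")
      case True
      have "0 < u' w0" "0 < u' (?W \<theta> s)"
        using u'_pos w0_dom feas by (auto simp: feasible_def)
      then have "0 \<le> u' w0 * \<bar>S s - \<pi>\<bar>" "0 \<le> pmf Q s * (u' (?W \<theta> s) * (S s - \<pi>))"
        using True by simp_all
      then show ?thesis
        by linarith
    next
      case False
      then have "w0 \<le> ?W \<theta> s"
        using \<theta> by (simp add: wealth_def mult_nonpos_nonpos)
      then have "u' (?W \<theta> s) \<le> u' w0" "0 < u' (?W \<theta> s)"
        using u'_antimono[OF w0_dom] u'_pos feas by (auto simp: feasible_def)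
      then have "pmf Q s * (u' (?W \<theta> s) * (\<pi> - S s)) \<le> 1 * (u' w0 * (\<pi> - S s))"
        using False by (intro mult_mono) (auto simp: pmf_le_1)
      then show ?thesis
        using False by (simp add: algebra_simps)
    qed
    have "C < u' x * (\<eta> * (S h - \<pi>))"
      using x(3) \<eta>(1) gap by (simp add: pos_divide_less_eq)
    also have "\<dots> \<le> pmf Q h * (u' (?W \<theta> h) * (S h - \<pi>))"
      using \<eta> Q(1) gap u'_pos[OF x(1)] by (simp add: Wh mult.left_commute mult_right_mono)
    finally have big: "C < pmf Q h * (u' (?W \<theta> h) * (S h - \<pi>))" .
    have "- C \<le> (\<Sum>s\<in>UNIV-{h}. - (u' w0 * \<bar>S s - \<pi>\<bar>))"
      unfolding C_def sum_negf neg_le_iff_le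
      using u'_pos[OF w0_dom] by (intro sum_mono2) auto
    also have "\<dots> \<le> (\<Sum>s\<in>UNIV-{h}. pmf Q s * (u' (?W \<theta> s) * (S s - \<pi>)))"
      by (intro sum_mono lower)
    finally have "0 < (\<Sum>s\<in>UNIV. pmf Q s * (u' (?W \<theta> s) * (S s - \<pi>)))"
      using big by (subst sum.remove[of _ h]) auto
    then show ?thesis
      by (simp add: Q(2) expectation_pmf_finite)
  qed
  with feas show thesis
    by (rule that)
qed

text \<open>Positive slopes for \<open>S\<close> and for its reflection confine the search to a
  compact interval of feasible positions, where continuity gives a maximizer. Two maximizers would
  be beaten by their midpoint.\<close>

lemma optimal_ex1:
  assumes "no_arbitrage S \<pi>"
  shows "\<exists>!\<theta>. optimal S \<pi> \<theta>"
proof (rule ex_ex1I)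
  obtain a where a: "a \<in> feasible S \<pi>" "0 < slope S \<pi> a"
    using ex_slope_pos[OF assms] by blast
  obtain b' where b': "b' \<in> feasible (\<lambda>s. - S s) (- \<pi>)" "0 < slope (\<lambda>s. - S s) (- \<pi>) b'"
    using ex_slope_pos assms no_arbitrage_uminus by metis
  define b where "b = - b'"
  have b: "b \<in> feasible S \<pi>"
    using b'(1) feasible_uminus[of b S \<pi>] by (simp add: b_def)
  have left: "criterion S \<pi> \<theta> < criterion S \<pi> a" if "\<theta> \<in> feasible S \<pi>" "\<theta> < a" for \<theta>
    using criterion_less_if_slope_pos[OF a that] .
  have right: "criterion S \<pi> \<theta> < criterion S \<pi> b" if "\<theta> \<in> feasible S \<pi>" "b < \<theta>" for \<theta>
    using criterion_less_if_slope_pos[OF b', of "- \<theta>"] that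
      criterion_uminus[of S \<pi> \<theta>] criterion_uminus[of S \<pi> b]
    by (simp add: b_def feasible_uminus)
  \<comment> \<open>Otherwise \<open>left\<close> and \<open>right\<close> would make each of
    \<open>a\<close> and \<open>b\<close> strictly better than the other.\<close>
  have "a \<le> b"
    using left[OF b] right[OF a(1)] by force
  moreover have ab: "\<theta> \<in> feasible S \<pi>" if "\<theta> \<in> {a..b}" for \<theta>
    using feasible_between[OF a(1) b] that by auto
  then have "continuous_on {a..b} (criterion S \<pi>)"
    unfolding continuous_on_def by (intro ballI tendsto_criterion tendsto_const tendsto_ident_at)
  ultimately obtain t where t: "t \<in> {a..b}" "\<forall>\<theta>\<in>{a..b}. criterion S \<pi> \<theta> \<le> criterion S \<pi> t"
    using continuous_attains_sup[of "{a..b}" "criterion S \<pi>"] by auto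
  have "optimal S \<pi> t"
    unfolding optimal_def
  proof (intro conjI ballI)
    fix \<theta> assume \<theta>: "\<theta> \<in> feasible S \<pi>"
    have "criterion S \<pi> a \<le> criterion S \<pi> t" "criterion S \<pi> b \<le> criterion S \<pi> t"
      using t(2) \<open>a \<le> b\<close> by auto
    then show "criterion S \<pi> \<theta> \<le> criterion S \<pi> t"
      using left[OF \<theta>] right[OF \<theta>] t(2) by (cases "\<theta> < a"; cases "b < \<theta>") auto
  qed (use ab t in auto)
  then show "\<exists>\<theta>. optimal S \<pi> \<theta>"
    by blast
next
  have "\<not> x < y" if "optimal S \<pi> x" "optimal S \<pi> y" for x y
  proof
    assume "x < y"
    then have "min (criterion S \<pi> x) (criterion S \<pi> y) < criterion S \<pi> ((x + y) / 2)"
        "(x + y) / 2 \<in> feasible S \<pi>"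
      using that criterion_strictly_quasiconcave[OF _ _ _ _ assms, of x y "(x + y) / 2"]
        feasible_between[of x S \<pi> y "(x + y) / 2"]
      by (auto simp: optimal_def)
    then show False
      using that by (force simp: optimal_def)
  qed
  then show "x = y" if "optimal S \<pi> x" "optimal S \<pi> y" for x y
    using that by (meson linorder_neqE_linordered_idom)
qed

lemma optimal_optimum: "no_arbitrage S \<pi> \<Longrightarrow> optimal S \<pi> (optimum S \<pi>)"
  unfolding optimum_def by (rule theI') (rule optimal_ex1)

lemma optimum_eqI: "no_arbitrage S \<pi> \<Longrightarrow> optimal S \<pi> \<theta> \<Longrightarrow> optimum S \<pi> = \<theta>"
  using optimal_optimum optimal_ex1 by blast

lemma optimum_uminus: "no_arbitrage S \<pi> \<Longrightarrow> optimum (\<lambda>s. - S s) (- \<pi>) = - optimum S \<pi>"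
  by (rule optimum_eqI) (simp_all add: no_arbitrage_uminus optimal_uminus optimal_optimum)

section \<open>Continuity of the optimum in the price\<close>

lemma eventually_no_arbitrage:
  assumes "no_arbitrage S \<pi>"
  shows "\<forall>\<^sub>F x in at \<pi>. no_arbitrage S x"
proof -
  obtain l h where "S l < \<pi>" "\<pi> < S h"
    using assms by (auto simp: no_arbitrage_def)
  then have "\<forall>\<^sub>F x in at \<pi>. S l < x \<and> x < S h"
    by (intro eventually_conj order_tendstoD[OF tendsto_ident_at])
  then show ?thesis
    by (rule eventually_mono) (auto simp: no_arbitrage_def)
qed

text \<open>At price \<pi> the optimum strictly beats the positions at distance \<open>h\<close> on
  either side. These two inequalities persist at nearby prices, and \<open>optimal_between\<close>
  then traps the new optimum.\<close>

lemma isCont_optimum: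
  assumes "no_arbitrage S \<pi>"
  shows "isCont (optimum S) \<pi>"
  unfolding isCont_def
proof (rule tendstoI)
  fix e :: real assume e: "0 < e"
  let ?V = "criterion S" and ?t = "optimum S \<pi>"
  have t: "?t \<in> feasible S \<pi>"
    using optimal_optimum[OF assms] by (simp add: optimal_def)
  have "((\<lambda>h. ?t + h) \<longlongrightarrow> ?t + 0) (at_right 0)" "((\<lambda>h. ?t - h) \<longlongrightarrow> ?t - 0) (at_right 0)"
    by (intro tendsto_intros)+
  then have "\<forall>\<^sub>F h in at_right 0. ?t + h \<in> feasible S \<pi> \<and> ?t - h \<in> feasible S \<pi> \<and> h \<in> {0<..<e}"
    using t e
    by (intro eventually_conj eventually_feasible[OF tendsto_const] eventually_at_right_real) auto
  then obtain h where h: "?t + h \<in> feasible S \<pi>" "?t - h \<in> feasible S \<pi>" "0 < h" "h < e"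
    using eventually_happens[of _ "at_right (0::real)"] trivial_limit_at_right_real by fastforce
  have less: "?V \<pi> x < ?V \<pi> ?t" if "x \<in> feasible S \<pi>" "x \<noteq> ?t" for x
  proof (rule ccontr)
    assume "\<not> ?V \<pi> x < ?V \<pi> ?t"
    then have "optimal S \<pi> x"
      using that(1) optimal_optimum[OF assms] unfolding optimal_def by fastforce
    then show False
      using optimum_eqI[OF assms] that(2) by blast
  qed
  have ev: "\<forall>\<^sub>F p in at \<pi>. x \<in> feasible S p \<and> ?V p x < ?V p ?t"
    if x: "x \<in> feasible S \<pi>" "x \<noteq> ?t" for x
  proof (intro eventually_conj)
    show "\<forall>\<^sub>F p in at \<pi>. x \<in> feasible S p"
      by (intro eventually_feasible[OF tendsto_ident_at tendsto_const x(1)])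
    have "((\<lambda>p. ?V p ?t - ?V p x) \<longlongrightarrow> ?V \<pi> ?t - ?V \<pi> x) (at \<pi>)"
      by (intro tendsto_diff tendsto_criterion tendsto_ident_at tendsto_const t x(1))
    then have "\<forall>\<^sub>F p in at \<pi>. 0 < ?V p ?t - ?V p x"
      by (rule order_tendstoD) (use less[OF x] in simp)
    then show "\<forall>\<^sub>F p in at \<pi>. ?V p x < ?V p ?t"
      by simp
  qed
  have "\<forall>\<^sub>F p in at \<pi>. no_arbitrage S p \<and>
      (?t - h \<in> feasible S p \<and> ?V p (?t - h) < ?V p ?t) \<and>
      (?t + h \<in> feasible S p \<and> ?V p (?t + h) < ?V p ?t)"
    using h by (intro eventually_conj ev eventually_no_arbitrage assms) auto
  then show "\<forall>\<^sub>F p in at \<pi>. dist (optimum S p) ?t < e"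
  proof (rule eventually_mono)
    fix p
    assume p: "no_arbitrage S p \<and>
      (?t - h \<in> feasible S p \<and> ?V p (?t - h) < ?V p ?t) \<and>
      (?t + h \<in> feasible S p \<and> ?V p (?t + h) < ?V p ?t)"
    then have "?t - h < optimum S p \<and> optimum S p < ?t + h"
      using h by (intro optimal_between[OF optimal_optimum]) auto
    then show "dist (optimum S p) ?t < e"
      using h(4) by (auto simp: dist_real_def)
  qed
qed

section \<open>Sign of the optimal position\<close>

lemma worst_const: "worst (\<lambda>_. x) = x"
  by (rule worst_attained[of "\<lambda>_. x"]) simp

lemma criterion_zero: "criterion S \<pi> 0 = u w0"
  by (simp add: criterion_def wealth_def worst_const)

text \<open>The test prior is the one minimizing the mean of \<open>S\<close> itself. Under it a
  long position has no positive expected gain, and the tangent at \<open>w0\<close> carries this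
  over to utility.\<close>

lemma criterion_le_if_worst_le:
  assumes "worst S \<le> \<pi>" "0 \<le> \<theta>" "\<theta> \<in> feasible S \<pi>"
  shows "criterion S \<pi> \<theta> \<le> criterion S \<pi> 0"
proof -
  obtain Q where Q: "Q \<in> K" "worst S = measure_pmf.expectation Q S"
    by (rule worst_attained)
  have "criterion S \<pi> \<theta> \<le> (\<Sum>s\<in>UNIV. pmf Q s * u (wealth w0 S \<pi> \<theta> s))"
    unfolding criterion_def using worst_le[OF Q(1)] by (simp add: expectation_pmf_finite)
  also have "\<dots> \<le> (\<Sum>s\<in>UNIV. pmf Q s * (u w0 + u' w0 * (wealth w0 S \<pi> \<theta> s - w0)))"
    using assms(3) w0_dom
    by (intro sum_mono mult_left_mono u_le_tangent) (auto simp: feasible_def)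
  also have "\<dots> = (\<Sum>s\<in>UNIV. pmf Q s * u w0) + (\<Sum>s\<in>UNIV. u' w0 * \<theta> * (pmf Q s * (S s - \<pi>)))"
    unfolding sum.distrib[symmetric] by (simp add: wealth_def algebra_simps)
  also have "\<dots> = u w0 + u' w0 * \<theta> * (worst S - \<pi>)"
    by (simp add: sum_distrib_left[symmetric] sum_distrib_right[symmetric] sum_pmf_UNIV
        sum_pmf_deviation Q(2))
  also have "\<dots> \<le> u w0"
    using assms(1,2) u'_pos[OF w0_dom] by (simp add: mult_nonneg_nonpos)
  finally show ?thesis
    by (simp add: criterion_zero)
qed

lemma optimum_eq_0:
  assumes "no_arbitrage S \<pi>" "worst S \<le> \<pi>" "worst (\<lambda>s. - S s) \<le> - \<pi>"
  shows "optimum S \<pi> = 0"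
proof (rule optimum_eqI[OF assms(1)])
  have "criterion S \<pi> \<theta> \<le> criterion S \<pi> 0" if "\<theta> \<in> feasible S \<pi>" for \<theta>
  proof (cases "0 \<le> \<theta>")
    case True
    then show ?thesis
      using criterion_le_if_worst_le[OF assms(2)] that by blast
  next
    case False
    then have "criterion (\<lambda>s. - S s) (- \<pi>) (- \<theta>) \<le> criterion (\<lambda>s. - S s) (- \<pi>) 0"
      using that by (intro criterion_le_if_worst_le assms(3)) (auto simp: feasible_uminus)
    then show ?thesis
      by (simp add: criterion_uminus criterion_zero)
  qed
  then show "optimal S \<pi> 0"
    by (simp add: optimal_def zero_feasible)
qed

lemma optimum_pos:
  assumes "no_arbitrage S \<pi>" "\<pi> < worst S"
  shows "0 < optimum S \<pi>"
proof -
  obtain Q where Q: "Q \<in> K" "slope S \<pi> 0 = measure_pmf.expectation Q (\<lambda>s. u' w0 * (S s - \<pi>))"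
    by (rule worst_attained[of "\<lambda>s. u' w0 * (S s - \<pi>)"])
      (simp only: slope_def wealth_def mult_zero_left add_0_right)
  then have "slope S \<pi> 0 = u' w0 * (measure_pmf.expectation Q S - \<pi>)"
    by (simp add: expectation_pmf_finite mult.left_commute sum_distrib_left[symmetric]
        sum_pmf_deviation)
  moreover have "\<pi> < measure_pmf.expectation Q S"
    using worst_le[OF Q(1), of S] assms(2) by simp
  ultimately have "0 < slope S \<pi> 0"
    using u'_pos[OF w0_dom] by simp
  \<comment> \<open>A positive slope at 0 would only give a nonnegative optimum. By continuity the
    slope is still positive at some \<open>h > 0\<close>, and the optimum is at least
    \<open>h\<close>.\<close>
  then have "\<forall>\<^sub>F h in at_right 0. 0 < slope S \<pi> h"
    using tendsto_slope[OF tendsto_const tendsto_ident_at zero_feasible] order_tendstoD(1) by blast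
  moreover have "\<forall>\<^sub>F h in at_right 0. h \<in> feasible S \<pi>"
    by (intro eventually_feasible[OF tendsto_const tendsto_ident_at zero_feasible])
  moreover have "\<forall>\<^sub>F h::real in at_right 0. 0 < h"
    by (rule eventually_at_right_less)
  ultimately have "\<forall>\<^sub>F h in at_right 0. 0 < slope S \<pi> h \<and> h \<in> feasible S \<pi> \<and> 0 < h"
    by eventually_elim auto
  then obtain h where "0 < slope S \<pi> h" "h \<in> feasible S \<pi>" "0 < h"
    using eventually_happens[of _ "at_right (0::real)"] trivial_limit_at_right_real by fastforce
  then show ?thesis
    using optimal_ge_if_slope_pos[OF optimal_optimum[OF assms(1)]] by force
qed

section \<open>Limits at the extreme payoffs\<close>

lemma worst_gt:
  assumes "\<And>s. m \<le> f s" "m < f h"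
  shows "m < worst f"
proof -
  obtain Q where Q: "Q \<in> K" "worst f = measure_pmf.expectation Q f"
    by (rule worst_attained)
  have "0 < (\<Sum>s\<in>UNIV. pmf Q s * (f s - m))"
    using assms weights_pos[OF Q(1)] by (intro sum_pos2[of _ h]) auto
  then show ?thesis
    by (simp add: Q(2) sum_pmf_deviation)
qed

text \<open>At the limiting price \<open>m\<close> a long position never loses and gains in state
  \<open>h\<close>, so every \<open>M \<ge> 0\<close> is feasible with positive slope. Both facts
  survive slightly above \<open>m\<close>, which forces the optimum to be at least
  \<open>M\<close>.\<close>

lemma filterlim_optimum:
  assumes "\<And>s. m \<le> S s" "S l = m" "m < S h"
  shows "filterlim (optimum S) at_top (at_right m)"
  unfolding filterlim_at_top_ge[where c = 0]
proof (intro allI impI)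
  fix M :: real assume M: "0 \<le> M"
  have W: "w0 \<le> wealth w0 S m M s" for s
    using M assms(1)[of s] by (simp add: wealth_def)
  then have feas: "M \<in> feasible S m"
    using up_closed[OF w0_dom] by (auto simp: feasible_def)
  have u'W: "0 < u' (wealth w0 S m M s)" for s
    using feas u'_pos by (auto simp: feasible_def)
  have "0 < slope S m M"
    unfolding slope_def
  proof (rule worst_gt)
    show "0 \<le> u' (wealth w0 S m M s) * (S s - m)" for s
      using u'W[of s] assms(1)[of s] by simp
    show "0 < u' (wealth w0 S m M h) * (S h - m)"
      using u'W[of h] assms(3) by simp
  qed
  then have "\<forall>\<^sub>F p in at_right m. 0 < slope S p M"
    using tendsto_slope[OF tendsto_ident_at tendsto_const feas] order_tendstoD(1) by blast
  moreover have "\<forall>\<^sub>F p in at_right m. M \<in> feasible S p"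
    by (intro eventually_feasible[OF tendsto_ident_at tendsto_const feas])
  moreover have "\<forall>\<^sub>F p in at_right m. p \<in> {m<..<S h}"
    using assms(3) by (rule eventually_at_right_real)
  ultimately show "\<forall>\<^sub>F p in at_right m. M \<le> optimum S p"
  proof eventually_elim
    case (elim p)
    then have "no_arbitrage S p"
      using assms(2) by (auto simp: no_arbitrage_def)
    then show ?case
      using elim optimal_ge_if_slope_pos optimal_optimum by blast
  qed
qed

lemma filterlim_optimum_at_left:
  assumes "\<And>s. S s \<le> m" "S h = m" "S l < m"
  shows "filterlim (optimum S) at_bot (at_left m)"
proof -
  have "filterlim (\<lambda>\<pi>. optimum (\<lambda>s. - S s) (- \<pi>)) at_top (at_left m)"
    unfolding filterlim_at_left_to_right
    using filterlim_optimum[of "- m" "\<lambda>s. - S s" h l] assms by simp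
  moreover have "\<forall>\<^sub>F \<pi> in at_left m. optimum (\<lambda>s. - S s) (- \<pi>) = - optimum S \<pi>"
    using eventually_at_left_real[OF assms(3)]
  proof eventually_elim
    case (elim \<pi>)
    then show ?case
      using assms(2) by (intro optimum_uminus) (auto simp: no_arbitrage_def)
  qed
  ultimately have "filterlim (\<lambda>\<pi>. - optimum S \<pi>) at_top (at_left m)"
    using filterlim_cong[OF refl refl] by fast
  then show ?thesis
    by (simp add: filterlim_uminus_at_bot)
qed

end

section \<open>Divergence of the admissible bounds\<close>

lemma tendsto_admissible_upper:
  assumes "k = Positive_Half_Line \<Longrightarrow> 0 < w0"
  shows "(admissible_upper k w0 S \<longlongrightarrow> \<infinity>) (at_right (MIN s. S s))"
proof (cases k)
  case Whole_Line
  then have "admissible_upper k w0 S = (\<lambda>_. \<infinity>)"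
    by auto
  then show ?thesis
    by simp
next
  case Positive_Half_Line
  let ?m = "MIN s. S s"
  have "((\<lambda>\<pi>. \<pi> - ?m) \<longlongrightarrow> ?m - ?m) (at_right ?m)"
    by (intro tendsto_intros)
  then have "filterlim (\<lambda>\<pi>. w0 / (\<pi> - ?m)) at_top (at_right ?m)"
    using assms[OF Positive_Half_Line] eventually_at_right_less[of ?m]
    by (intro LIM_at_top_divide[OF tendsto_const]) auto
  moreover have "admissible_upper k w0 S = (\<lambda>\<pi>. ereal (w0 / (\<pi> - ?m)))"
    using Positive_Half_Line by auto
  ultimately show ?thesis
    by (simp add: tendsto_PInfty_eq_at_top)
qed

lemma MIN_uminus:
  fixes S :: "'d::finite \<Rightarrow> real"
  shows "(MIN s. - S s) = - (MAX s. S s)"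
  using minus_Max_eq_Min[of "range S"] by (simp add: image_image)

lemma tendsto_admissible_lower:
  assumes "k = Positive_Half_Line \<Longrightarrow> 0 < w0"
  shows "(admissible_lower k w0 S \<longlongrightarrow> -\<infinity>) (at_left (MAX s. S s))"
proof -
  let ?T = "\<lambda>s. - S s"
  have "admissible_lower k w0 S = (\<lambda>\<pi>. - admissible_upper k w0 ?T (- \<pi>))"
    by (cases k) (simp_all only: admissible_lower.simps admissible_upper.simps MIN_uminus
        fun_eq_iff, simp_all del: minus_Max_eq_Min)
  moreover have "((\<lambda>\<pi>. admissible_upper k w0 ?T (- \<pi>)) \<longlongrightarrow> \<infinity>) (at_left (MAX s. S s))"
    unfolding filterlim_at_left_to_right
    using tendsto_admissible_upper[OF assms, where S = ?T] by (simp add: MIN_uminus)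
  ultimately show ?thesis
    using tendsto_uminus_ereal by fastforce
qed

section \<open>Reduction of the \<alpha>-maxmin problem to the worst-case investor\<close>

lemma reference_prior_if_Min:
  fixes P0 :: "'d::finite pmf"
  assumes "2 \<le> CARD('d)" "\<And>s. 0 < pmf P0 s" "1 \<le> c" "c < (MIN s. 1 / (1 - pmf P0 s))"
  shows "reference_prior P0 c"
proof
  fix s :: 'd
  have "UNIV \<noteq> {s}"
  proof
    assume "UNIV = {s}"
    then have "CARD('d) = card {s}"
      by simp
    then show False
      using assms(1) by simp
  qed
  then have "0 < (\<Sum>t\<in>UNIV-{s}. pmf P0 t)"
    using assms(2) by (intro sum_pos) auto
  then show "pmf P0 s < 1"
    by (simp add: sum_pmf_others)
  moreover have "c < 1 / (1 - pmf P0 s)"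
    using assms(4) by simp
  ultimately show "c * (1 - pmf P0 s) < 1"
    by (simp add: pos_less_divide_eq)
qed (rule assms)+

lemma (in reference_prior) alpha_maxmin_eq:
  "alpha_maxmin \<alpha> u P0 b w0 S \<pi> \<theta> =
    mean0 (\<lambda>s. u (wealth w0 S \<pi> \<theta> s)) -
      ambiguity_delta b \<alpha> * std_dev P0 (\<lambda>s. u (wealth w0 S \<pi> \<theta> s))"
  unfolding alpha_maxmin_def INF_prior_set SUP_prior_set ambiguity_delta_def
  by (simp add: algebra_simps)

theorem proposition2p8:
  fixes P0 :: "'d::finite pmf"
    and S :: "'d \<Rightarrow> real"
    and u :: "real \<Rightarrow> real"
    and k :: utility_case
    and c \<alpha> w0 S_min S_max :: real
    and \<theta>_opt :: "real \<Rightarrow> real"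
  defines "S_min \<equiv> MIN s. S s"
    and "S_max \<equiv> MAX s. S s"
    and "\<theta>_opt \<equiv> demand k \<alpha> u P0 c w0 S"
  assumes "CARD('d) \<ge> 2"
    and "\<And>s. pmf P0 s > 0"
    and "c \<ge> 1"
    and "c < (MIN s. 1 / (1 - pmf P0 s))"
    and "\<exists>s t. S s \<noteq> S t"
    and "\<alpha> \<in> {1/2..1}"
    and "k = Positive_Half_Line \<Longrightarrow> w0 > 0"
    and "strictly_concave_on (utility_dom k) u"
    and "twice_differentiable_on (utility_dom k) u"
    and "inada k u"
  shows
    "(\<forall>\<pi>\<in>{S_min<..<S_max}. \<exists>!\<theta>. is_optimal k \<alpha> u P0 c w0 S \<pi> \<theta>) \<and>
     (continuous_on {S_min<..<S_max} \<theta>_opt \<and>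
      (\<forall>\<pi>\<in>{lower_price \<alpha> P0 c S..upper_price \<alpha> P0 c S}. \<theta>_opt \<pi> = 0) \<and>
      (\<forall>\<pi>\<in>{S_min<..<lower_price \<alpha> P0 c S}. \<theta>_opt \<pi> > 0) \<and>
      (\<forall>\<pi>\<in>{upper_price \<alpha> P0 c S<..<S_max}. \<theta>_opt \<pi> < 0)) \<and>
     (((admissible_upper k w0 S) \<longlongrightarrow> \<infinity>) (at_right S_min) \<and>
      ((\<lambda>\<pi>. ereal (\<theta>_opt \<pi>)) \<longlongrightarrow> \<infinity>) (at_right S_min) \<and>
      ((admissible_lower k w0 S) \<longlongrightarrow> -\<infinity>) (at_left S_max) \<and>
      ((\<lambda>\<pi>. ereal (\<theta>_opt \<pi>)) \<longlongrightarrow> -\<infinity>) (at_left S_max))"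
proof -
  define \<delta> where "\<delta> = ambiguity_delta c \<alpha>"
  have \<delta>: "0 \<le> \<delta>"
    using assms(6,9) by (simp add: \<delta>_def ambiguity_delta_def)
  \<comment> \<open>The factor \<open>2 * \<alpha> - 1\<close> has modulus at most 1, so the reduced
    bound does not exceed \<open>c\<close> and inherits its smallness; positivity of the reduced
    priors follows.\<close>
  have "(2 * \<alpha> - 1)\<^sup>2 \<le> 1"
    using assms(9) by (intro power_le_one) auto
  then have "(c - 1) * (2 * \<alpha> - 1)\<^sup>2 \<le> (c - 1) * 1"
    using assms(6) by (intro mult_left_mono) auto
  then have \<delta>_le: "1 + \<delta>\<^sup>2 \<le> c"
    using assms(6) by (simp add: \<delta>_def ambiguity_delta_def power_mult_distrib)
  interpret full: reference_prior P0 c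
    by (rule reference_prior_if_Min) fact+
  interpret reduced: reference_prior P0 "1 + \<delta>\<^sup>2"
  proof
    show "(1 + \<delta>\<^sup>2) * (1 - pmf P0 s) < 1" for s
      using mult_right_mono[OF \<delta>_le, of "1 - pmf P0 s"] full.bound_small[of s]
        full.nondegenerate[of s] by linarith
  qed (auto simp: full.full_support full.nondegenerate)
  interpret inada_utility "utility_dom k" u "deriv u"
    by (rule inada_utility_deriv) fact+
  interpret robust_investor "utility_dom k" u "deriv u" "prior_set P0 (1 + \<delta>\<^sup>2)" w0
  proof
    fix f :: "'d \<Rightarrow> real"
    show "\<exists>Q\<in>prior_set P0 (1 + \<delta>\<^sup>2). \<forall>P\<in>prior_set P0 (1 + \<delta>\<^sup>2).
        measure_pmf.expectation Q f \<le> measure_pmf.expectation P f"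
      using prior_set_INF_attained[OF assms(5) reduced.bound_ge_1, of f] by metis
  next
    show "w0 \<in> utility_dom k"
      using assms(10) by (cases k) auto
  qed (rule reduced.prior_pos)
  \<comment> \<open>The radius \<open>sqrt ((1 + \<delta>\<^sup>2) - 1)\<close> is \<delta> itself
    because \<delta> is nonnegative, which uses \<open>\<alpha> \<ge> 1/2\<close>.\<close>
  have worst_eq: "worst f = measure_pmf.expectation P0 f - \<delta> * std_dev P0 f" for f
    unfolding worst_def reduced.INF_prior_set using \<delta> by simp
  have objective: "alpha_maxmin \<alpha> u P0 c w0 S \<pi> \<theta> = criterion S \<pi> \<theta>" for \<pi> \<theta>
    by (simp add: full.alpha_maxmin_eq criterion_def worst_eq \<delta>_def[symmetric])
  have adm: "admissible k w0 S \<pi> = feasible S \<pi>" for \<pi>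
    unfolding feasible_def by (cases k) auto
  have opt: "is_optimal k \<alpha> u P0 c w0 S \<pi> \<theta> \<longleftrightarrow> optimal S \<pi> \<theta>" for \<pi> \<theta>
    unfolding is_optimal_def is_arg_max_def optimal_def
    by (auto simp only: objective adm not_less Ball_def)
  have \<theta>_opt: "\<theta>_opt = optimum S"
    by (rule ext) (simp only: \<theta>_opt_def demand_def optimum_def opt)
  \<comment> \<open>The two price bounds are the smallest and the largest mean payoff over the
    reduced priors.\<close>
  have lower: "lower_price \<alpha> P0 c S = worst S"
    using \<delta> by (simp add: lower_price_def worst_eq \<delta>_def[symmetric])
  have upper: "upper_price \<alpha> P0 c S = - worst (\<lambda>s. - S s)"
    using \<delta> by (simp add: upper_price_def worst_eq \<delta>_def[symmetric] std_dev_uminus)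
  have interior: "no_arbitrage S \<pi> \<longleftrightarrow> \<pi> \<in> {S_min<..<S_max}" for \<pi>
    by (auto simp: no_arbitrage_def S_min_def S_max_def Min_less_iff Max_gr_iff)
  have bounds: "S_min \<le> S s" "S s \<le> S_max" for s
    by (simp_all add: S_min_def S_max_def)
  have "S_min \<in> range S" "S_max \<in> range S"
    unfolding S_min_def S_max_def by (intro Min_in Max_in; simp)+
  then obtain l h where l: "S l = S_min" and h: "S h = S_max"
    by auto
  have lh: "S_min < S_max"
    using assms(8) bounds by (metis antisym le_less_linear order_trans)
  \<comment> \<open>Positive priors keep mean payoffs strictly inside the payoff range, so the whole
    closed interval of zero demand consists of arbitrage-free prices.\<close>
  have "S_min < worst S" "- S_max < worst (\<lambda>s. - S s)"
    using worst_gt[of S_min S h] worst_gt[of "- S_max" "\<lambda>s. - S s" l] bounds l h lh by auto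
  then have prices: "S_min < lower_price \<alpha> P0 c S" "upper_price \<alpha> P0 c S < S_max"
    by (auto simp: lower upper)
  have "worst S \<le> - worst (\<lambda>s. - S s)"
    using \<delta> by (simp add: worst_eq std_dev_uminus std_dev_nonneg)
  then have order: "lower_price \<alpha> P0 c S \<le> upper_price \<alpha> P0 c S"
    by (simp add: lower upper)
  have "\<forall>\<pi>\<in>{S_min<..<S_max}. \<exists>!\<theta>. is_optimal k \<alpha> u P0 c w0 S \<pi> \<theta>"
    using optimal_ex1 by (simp add: opt interior)
  moreover have "continuous_on {S_min<..<S_max} \<theta>_opt"
    unfolding \<theta>_opt using isCont_optimum interior by (blast intro: continuous_at_imp_continuous_on)
  moreover have "\<forall>\<pi>\<in>{lower_price \<alpha> P0 c S..upper_price \<alpha> P0 c S}. \<theta>_opt \<pi> = 0"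
    using prices unfolding \<theta>_opt by (auto intro!: optimum_eq_0 simp: interior lower upper)
  moreover have "\<forall>\<pi>\<in>{S_min<..<lower_price \<alpha> P0 c S}. \<theta>_opt \<pi> > 0"
    using prices order unfolding \<theta>_opt by (auto intro!: optimum_pos simp: interior lower)
  moreover have "\<forall>\<pi>\<in>{upper_price \<alpha> P0 c S<..<S_max}. \<theta>_opt \<pi> < 0"
  proof
    fix \<pi> assume \<pi>: "\<pi> \<in> {upper_price \<alpha> P0 c S<..<S_max}"
    then have "no_arbitrage S \<pi>"
      using prices order by (auto simp: interior)
    then show "\<theta>_opt \<pi> < 0"
      using optimum_pos[of "\<lambda>s. - S s" "- \<pi>"] \<pi> optimum_uminus[of S \<pi>]
      by (simp add: \<theta>_opt upper no_arbitrage_uminus)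
  qed
  moreover have "(admissible_upper k w0 S \<longlongrightarrow> \<infinity>) (at_right S_min)"
    unfolding S_min_def by (rule tendsto_admissible_upper) fact
  moreover have "((\<lambda>\<pi>. ereal (\<theta>_opt \<pi>)) \<longlongrightarrow> \<infinity>) (at_right S_min)"
    unfolding \<theta>_opt tendsto_PInfty_eq_at_top
    by (rule filterlim_optimum[of _ _ l h]) (use bounds l h lh in auto)
  moreover have "(admissible_lower k w0 S \<longlongrightarrow> -\<infinity>) (at_left S_max)"
    unfolding S_max_def by (rule tendsto_admissible_lower) fact
  moreover have "((\<lambda>\<pi>. ereal (\<theta>_opt \<pi>)) \<longlongrightarrow> -\<infinity>) (at_left S_max)"
  proof -
    have "filterlim (optimum S) at_bot (at_left S_max)"
      by (rule filterlim_optimum_at_left[of _ _ h l]) (use bounds l h lh in auto)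
    then have "((\<lambda>\<pi>. ereal (- optimum S \<pi>)) \<longlongrightarrow> \<infinity>) (at_left S_max)"
      by (simp only: filterlim_uminus_at_bot tendsto_PInfty_eq_at_top)
    then show ?thesis
      using tendsto_uminus_ereal by (fastforce simp: \<theta>_opt)
  qed
  ultimately show ?thesis
    by blast
qed

end
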